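(* Let $\mathbb{K}\in\{\mathbb{R},\mathbb{C},\mathbb{H}\}$ and $0\le k\le n$. For every $x=\begin{pmatrix}T\\P\end{pmatrix}\in \mathrm{O}_{n,k}$, with $T\in\mathbb{K}^{(n-k)\times k}$ and $P\in\mathbb{K}^{k\times k}$, the open subset $$\Omega^x=\left\{\begin{pmatrix}\tau\\ \pi\end{pmatrix}\in \mathrm{O}_{n,k} : \pi\in\mathbb{K}^{k\times k},\ \pi+P^*\text{ is invertible}\right\}$$ is contractible in $\mathrm{O}_{n,k}$.
   Context: $\mathbb{K}$ is $\mathbb{R}$, $\mathbb{C}$ or the quaternions $\mathbb{H}$. For a matrix $A$, $A^*=\bar A^t$ is the conjugate transpose. The Stiefel manifold is $\mathrm{O}_{n,k}=\{x\in\mathbb{K}^{n\times k} : x^*x=I_k\}$. A subset $U$ of a space $E$ is contractible in $E$ if the inclusion $U\hookrightarrow E$ is homotopic to a constant map, i.e. there is a continuous map $H\colon U\times[0,1]\to E$ with $H(y,1)=y$ for all $y\in U$ and $H(\cdot,0)$ constant. *)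

theory Defs
  imports "HOL-Analysis.Analysis" "Jordan_Normal_Form.Conjugate" "Jordan_Normal_Form.Matrix"
begin

section \<open>The quaternions\<close>

text \<open>The element \<open>Quat a b c d\<close> is $a + b i + c j + d k$.\<close>

datatype quat = Quat (qRe: real) (qIm1: real) (qIm2: real) (qIm3: real)

lemma quat_eq_iff:
  "p = q \<longleftrightarrow> qRe p = qRe q \<and> qIm1 p = qIm1 q \<and> qIm2 p = qIm2 q \<and> qIm3 p = qIm3 q"
  by (cases p; cases q) simp

instantiation quat :: real_div_algebra
begin

definition zero_quat :: quat
  where "0 = Quat 0 0 0 0"

definition one_quat :: quat
  where "1 = Quat 1 0 0 0"

definition plus_quat :: "quat \<Rightarrow> quat \<Rightarrow> quat"
  where "p + q = Quat (qRe p + qRe q) (qIm1 p + qIm1 q) (qIm2 p + qIm2 q) (qIm3 p + qIm3 q)"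

definition uminus_quat :: "quat \<Rightarrow> quat"
  where "- p = Quat (- qRe p) (- qIm1 p) (- qIm2 p) (- qIm3 p)"

definition minus_quat :: "quat \<Rightarrow> quat \<Rightarrow> quat"
  where "p - q = Quat (qRe p - qRe q) (qIm1 p - qIm1 q) (qIm2 p - qIm2 q) (qIm3 p - qIm3 q)"

definition scaleR_quat :: "real \<Rightarrow> quat \<Rightarrow> quat"
  where "scaleR r p = Quat (r * qRe p) (r * qIm1 p) (r * qIm2 p) (r * qIm3 p)"

text \<open>The bilinear extension of $i^2 = j^2 = k^2 = ijk = -1$.\<close>

definition times_quat :: "quat \<Rightarrow> quat \<Rightarrow> quat"
  where "p * q = Quat
    (qRe p * qRe q - qIm1 p * qIm1 q - qIm2 p * qIm2 q - qIm3 p * qIm3 q)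
    (qRe p * qIm1 q + qIm1 p * qRe q + qIm2 p * qIm3 q - qIm3 p * qIm2 q)
    (qRe p * qIm2 q - qIm1 p * qIm3 q + qIm2 p * qRe q + qIm3 p * qIm1 q)
    (qRe p * qIm3 q + qIm1 p * qIm2 q - qIm2 p * qIm1 q + qIm3 p * qRe q)"

definition inverse_quat :: "quat \<Rightarrow> quat"
  where "inverse p = (let s = (qRe p)\<^sup>2 + (qIm1 p)\<^sup>2 + (qIm2 p)\<^sup>2 + (qIm3 p)\<^sup>2
    in Quat (qRe p / s) (- qIm1 p / s) (- qIm2 p / s) (- qIm3 p / s))"

definition divide_quat :: "quat \<Rightarrow> quat \<Rightarrow> quat"
  where "p div q = p * inverse q" for p q :: quat

instance
proof
  fix p q r :: quat and a b :: real
  note defs = zero_quat_def one_quat_def plus_quat_def uminus_quat_def minus_quat_def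
    scaleR_quat_def times_quat_def
  show "p + q + r = p + (q + r)" "p + q = q + p" "0 + p = p" "- p + p = 0" "p - q = p + - q"
    "a *\<^sub>R (p + q) = a *\<^sub>R p + a *\<^sub>R q" "(a + b) *\<^sub>R p = a *\<^sub>R p + b *\<^sub>R p"
    "a *\<^sub>R b *\<^sub>R p = (a * b) *\<^sub>R p" "1 *\<^sub>R p = p"
    "p * q * r = p * (q * r)" "1 * p = p" "p * 1 = p"
    "(p + q) * r = p * r + q * r" "p * (q + r) = p * q + p * r"
    "a *\<^sub>R p * q = a *\<^sub>R (p * q)" "p * a *\<^sub>R q = a *\<^sub>R (p * q)"
    "(0::quat) \<noteq> 1"
    by (simp_all add: quat_eq_iff defs algebra_simps)
  show "p div q = p * inverse q"
    by (rule divide_quat_def)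
  show "inverse (0::quat) = 0"
    by (simp add: inverse_quat_def zero_quat_def)
  assume "p \<noteq> 0"
  define s where "s = (qRe p)\<^sup>2 + (qIm1 p)\<^sup>2 + (qIm2 p)\<^sup>2 + (qIm3 p)\<^sup>2"
  have "s \<noteq> 0"
    using \<open>p \<noteq> 0\<close> unfolding s_def quat_eq_iff zero_quat_def quat.sel
    by (smt (verit) zero_le_power2 power2_eq_iff_nonneg zero_power2 power2_less_eq_zero_iff)
  moreover have "qRe p * qRe p + qIm1 p * qIm1 p + qIm2 p * qIm2 p + qIm3 p * qIm3 p = s"
    by (simp add: s_def power2_eq_square)
  ultimately show "inverse p * p = 1" "p * inverse p = 1"
    by (simp_all add: inverse_quat_def s_def[symmetric] times_quat_def one_quat_def mult.commute
        add_divide_distrib[symmetric] diff_divide_distrib[symmetric])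
qed

end

instantiation quat :: real_normed_div_algebra
begin

definition norm_quat :: "quat \<Rightarrow> real"
  where "norm p = sqrt ((qRe p)\<^sup>2 + (qIm1 p)\<^sup>2 + (qIm2 p)\<^sup>2 + (qIm3 p)\<^sup>2)"

definition sgn_quat :: "quat \<Rightarrow> quat"
  where "sgn p = p /\<^sub>R norm p" for p :: quat

definition dist_quat :: "quat \<Rightarrow> quat \<Rightarrow> real"
  where "dist p q = norm (p - q)" for p q :: quat

definition uniformity_quat :: "(quat \<times> quat) filter"
  where "uniformity_quat = (INF e\<in>{0 <..}. principal {(p, q). dist p q < e})"

definition open_quat :: "quat set \<Rightarrow> bool"
  where "open_quat U \<longleftrightarrow> (\<forall>p\<in>U. eventually (\<lambda>(p', q). p' = p \<longrightarrow> q \<in> U) uniformity)"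

instance
proof
  fix p q :: quat and a :: real
  have norm_prod: "norm u = norm ((qRe u, qIm1 u), (qIm2 u, qIm3 u))" for u :: quat
    by (simp add: norm_quat_def norm_Pair add.assoc)
  show "norm p = 0 \<longleftrightarrow> p = 0"
    unfolding norm_prod by (simp add: quat_eq_iff zero_quat_def zero_prod_def)
  show "norm (p + q) \<le> norm p + norm q"
    using norm_triangle_ineq[of "((qRe p, qIm1 p), (qIm2 p, qIm3 p))"
        "((qRe q, qIm1 q), (qIm2 q, qIm3 q))"]
    unfolding norm_prod by (simp add: plus_quat_def)
  show "norm (a *\<^sub>R p) = \<bar>a\<bar> * norm p"
    by (simp add: norm_quat_def scaleR_quat_def power_mult_distrib real_sqrt_mult
        flip: distrib_left)
  show "norm (p * q) = norm p * norm q"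
    unfolding norm_quat_def real_sqrt_mult[symmetric]
    by (rule arg_cong[where f = sqrt]) (simp add: times_quat_def power2_eq_square algebra_simps)
qed (rule sgn_quat_def dist_quat_def uniformity_quat_def open_quat_def)+

end

text \<open>The class \<open>conjugate\<close> only asks for an involution, so the quaternions are an instance of it;
  they are not one of \<open>conjugatable_ring\<close>, which asks for \<open>conjugate (a * b) = conjugate a * conjugate b\<close>.\<close>

instantiation quat :: conjugate
begin

definition conjugate_quat :: "quat \<Rightarrow> quat"
  where "conjugate p = Quat (qRe p) (- qIm1 p) (- qIm2 p) (- qIm3 p)"

instance
  by standard (auto simp: conjugate_quat_def quat_eq_iff)

end


section \<open>Stiefel manifolds\<close>

text \<open>The library's \<open>mat_adjoint\<close> requires a (commutative) field, hence a separate definition.\<close>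

definition conj_transpose :: "'a::conjugate mat \<Rightarrow> 'a mat"
  where "conj_transpose A = transpose_mat (map_mat conjugate A)"

text \<open>The space of \<open>n\<close> by \<open>k\<close> matrices with the product topology of their entries. The type of
  matrices carries no topology of its own, and it contains matrices of all sizes, including
  those with no rows or no columns.\<close>

definition mat_topology :: "nat \<Rightarrow> nat \<Rightarrow> 'a::topological_space mat topology"
  where "mat_topology n k = pullback_topology (carrier_mat n k)
    (\<lambda>A. restrict (\<lambda>ij. A $$ ij) ({..<n} \<times> {..<k}))
    (product_topology (\<lambda>_. euclidean) ({..<n} \<times> {..<k}))"

definition stiefel :: "nat \<Rightarrow> nat \<Rightarrow> 'a::{conjugate, semiring_1} mat set"
  where "stiefel n k = {x \<in> carrier_mat n k. conj_transpose x * x = 1\<^sub>m k}"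

definition stiefel_space ::
    "nat \<Rightarrow> nat \<Rightarrow> 'a::{conjugate, semiring_1, topological_space} mat topology"
  where "stiefel_space n k = subtopology (mat_topology n k) (stiefel n k)"

text \<open>The set $\Omega^x$ depends only on the lower square block \<open>P\<close> of \<open>x\<close>.\<close>

definition stiefel_Omega :: "nat \<Rightarrow> nat \<Rightarrow> 'a::{conjugate, semiring_1} mat \<Rightarrow> 'a mat set"
  where "stiefel_Omega n k P = {\<tau> @\<^sub>r \<pi> | \<tau> \<pi>. \<tau> \<in> carrier_mat (n - k) k \<and> \<pi> \<in> carrier_mat k k \<and>
    \<tau> @\<^sub>r \<pi> \<in> stiefel n k \<and> invertible_mat (\<pi> + conj_transpose P)}"

text \<open>Contractibility of a subset in the ambient space, which is weaker than contractibility of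
  the subset as a space of its own.\<close>

definition contractible_in :: "'a set \<Rightarrow> 'a topology \<Rightarrow> bool"
  where "contractible_in U E \<longleftrightarrow>
    U \<subseteq> topspace E \<and> (\<exists>c. homotopic_with (\<lambda>_. True) (subtopology E U) E (\<lambda>_. c) (\<lambda>y. y))"

end

theory Submission
  imports Defs
begin

text \<open>
  Write \<open>x = (T; P)\<close> and \<open>y = (\<tau>; \<pi>)\<close>. The contraction moves every \<open>y\<close> of the set along a straight
  segment to one fixed frame \<open>c\<close> and orthonormalises the points of the segment. Three facts make
  this work.

  There is a frame \<open>c\<close> in the Stiefel manifold whose lower block is \<open>P\<^sup>*\<close>
  (\<open>stiefel_conj_transpose_block\<close>). Indeed, complete \<open>x\<close> to a unitary matrix with lower rows
  \<open>(\<beta> P)\<close>; the rows of a unitary matrix are orthonormal too, so \<open>c = (\<beta>\<^sup>*; P\<^sup>*)\<close> has orthonormal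
  columns.

  Every point \<open>(1 - t) c + t y\<close> of the segment has full rank (\<open>lin_indep_segment\<close>). If it
  annihilates a vector \<open>a\<close>, then \<open>(1 - t) |c a| = t |y a|\<close>, and \<open>|c a| = |a| = |y a|\<close> because \<open>c\<close>
  and \<open>y\<close> are isometries. So \<open>a = 0\<close> or \<open>t = 1/2\<close>; in the second case \<open>(c + y) a = 0\<close>, whose lower
  block reads \<open>(\<pi> + P\<^sup>*) a = 0\<close>, and \<open>a = 0\<close> by invertibility.

  The Gram--Schmidt process is continuous on full-rank matrices (\<open>continuous_map_gram_schmidt\<close>) and
  fixes the orthonormal frames (\<open>gram_schmidt_orthonormal\<close>), hence the two ends of the homotopy are
  \<open>c\<close> and the inclusion.

  The set is open because a matrix \<open>M\<close> for which \<open>C M\<close> is close to the identity is injective, and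
  an injective square matrix is invertible. Since the quaternions are not commutative,
  determinants are avoided: the linear algebra rests on the fact that a homogeneous system with
  fewer equations than unknowns has a nontrivial solution (\<open>underdetermined_system\<close>), which holds
  over every division ring.
\<close>


section \<open>Division algebras with a norm-compatible conjugation\<close>

text \<open>A common roof for the three ground fields: the conjugation is an anti-automorphism, as it must
  be for the quaternions. The last axiom ties it to the norm, from which it
  follows that the conjugation fixes the real scalars and is isometric, hence continuous.\<close>

class conjugate_div_algebra = real_normed_div_algebra + conjugate +
  assumes conjugate_plus: "conjugate (a + b) = conjugate a + conjugate b"
    and conjugate_times: "conjugate (a * b) = conjugate b * conjugate a"
    and conjugate_times_self: "conjugate a * a = (norm a)\<^sup>2 *\<^sub>R 1"

context
  fixes a b :: "'a::conjugate_div_algebra"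
begin

lemma conjugate_0 [simp]: "conjugate 0 = (0::'a)"
  using conjugate_plus[of "0::'a" 0] by simp

lemma conjugate_of_real [simp]: "conjugate (of_real r) = (of_real r :: 'a)"
proof (cases "r = 0")
  case False
  then show ?thesis
    using conjugate_times_self[of "of_real r :: 'a"]
    by (simp add: power2_eq_square flip: of_real_def)
qed simp

lemma conjugate_diff: "conjugate (a - b) = conjugate a - conjugate b"
  using conjugate_plus[of "a - b" b] by (simp add: eq_diff_eq)

lemma conjugate_sum: "conjugate (sum f I) = (\<Sum>i\<in>I. conjugate (f i :: 'a))"
  by (induction I rule: infinite_finite_induct) (simp_all add: conjugate_plus)

lemma norm_conjugate [simp]: "norm (conjugate a) = norm a"
proof (cases "a = 0")
  case False
  have "norm (conjugate a) * norm a = norm a * norm a"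
    using arg_cong[OF conjugate_times_self[of a], of norm]
    by (simp add: norm_mult power2_eq_square)
  with False show ?thesis by simp
qed simp

end

instance real :: conjugate_div_algebra
  by standard (simp_all add: power2_eq_square mult.commute)

instance complex :: conjugate_div_algebra
proof
  fix a b :: complex
  show "conjugate a * a = (norm a)\<^sup>2 *\<^sub>R 1"
    using complex_norm_square[of a] by (simp add: scaleR_conv_of_real mult.commute[of a])
qed simp_all

instance quat :: conjugate_div_algebra
proof
  fix a b :: quat
  show "conjugate (a + b) = conjugate a + conjugate b"
    "conjugate (a * b) = conjugate b * conjugate a"
    by (simp_all add: quat_eq_iff conjugate_quat_def plus_quat_def times_quat_def algebra_simps)
  show "conjugate a * a = (norm a)\<^sup>2 *\<^sub>R 1"
    by (simp add: quat_eq_iff conjugate_quat_def times_quat_def norm_quat_def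
        scaleR_quat_def one_quat_def power2_eq_square algebra_simps)
qed


section \<open>Linear algebra over a division ring\<close>

text \<open>Gaussian elimination of one unknown per equation. Equations are combined by multiplication
  from the left while the unknowns stand on the right, so no two scalars need to commute. Arbitrary finite index sets
  spare the renumbering after the pivot column has been removed.\<close>

lemma underdetermined_system:
  fixes a :: "'i \<Rightarrow> 'j \<Rightarrow> 'a::division_ring"
  assumes "finite I" "finite J" "card I < card J"
  shows "\<exists>v. (\<exists>j\<in>J. v j \<noteq> 0) \<and> (\<forall>i\<in>I. (\<Sum>j\<in>J. a i j * v j) = 0)"
  using assms
proof (induction I arbitrary: J a rule: finite_induct)
  case empty
  then obtain j where "j \<in> J" by fastforce
  then show ?case by (intro exI[of _ "\<lambda>_. 1"]) auto
next
  case (insert r I)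
  show ?case
  proof (cases "\<exists>p\<in>J. a r p \<noteq> 0")
    case False
    have "card I < card J" using insert by simp
    from insert.IH[OF insert.prems(1) this, of a]
    obtain v where "\<exists>j\<in>J. v j \<noteq> 0" "\<forall>i\<in>I. (\<Sum>j\<in>J. a i j * v j) = 0" by blast
    moreover have "(\<Sum>j\<in>J. a r j * v j) = 0"
      using False by (intro sum.neutral) auto
    ultimately show ?thesis by blast
  next
    case True
    then obtain p where p: "p \<in> J" "a r p \<noteq> 0" by blast
    define J' where "J' = J - {p}"
    have J: "J = insert p J'" "p \<notin> J'" "finite J'"
      using p insert.prems by (auto simp: J'_def)
    have card: "card I < card J'"
      using insert.prems insert.hyps J by simp
    \<comment> \<open>solve row \<open>r\<close> for the pivot unknown and substitute into the other rows\<close>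
    define a' where "a' i j = a i j - a i p * inverse (a r p) * a r j" for i j
    obtain v where v: "\<exists>j\<in>J'. v j \<noteq> 0" "\<And>i. i \<in> I \<Longrightarrow> (\<Sum>j\<in>J'. a' i j * v j) = 0"
      using insert.IH[OF J(3) card, of a'] by blast
    define s where "s = (\<Sum>j\<in>J'. a r j * v j)"
    define w where "w = v(p := - inverse (a r p) * s)"
    have sum_w: "(\<Sum>j\<in>J. a i j * w j) = a i p * (- inverse (a r p) * s) + (\<Sum>j\<in>J'. a i j * v j)" for i
    proof -
      have "(\<Sum>j\<in>J'. a i j * w j) = (\<Sum>j\<in>J'. a i j * v j)"
        using J(2) by (intro sum.cong) (auto simp: w_def)
      then show ?thesis using J by (simp add: w_def)
    qed
    have "(\<Sum>j\<in>J. a i j * w j) = 0" if "i \<in> insert r I" for i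
    proof (cases "i = r")
      case True
      have "a r p * (inverse (a r p) * s) = s"
        using p(2) by (simp flip: mult.assoc)
      then show ?thesis unfolding sum_w True by (simp add: s_def)
    next
      case False
      with that have "i \<in> I" by simp
      have "(\<Sum>j\<in>J'. a' i j * v j) = (\<Sum>j\<in>J'. a i j * v j) - a i p * inverse (a r p) * s"
        by (simp add: a'_def s_def left_diff_distrib sum_subtractf sum_distrib_left mult.assoc)
      with v(2)[OF \<open>i \<in> I\<close>] show ?thesis
        unfolding sum_w by (simp add: mult.assoc)
    qed
    moreover have "\<exists>j\<in>J. w j \<noteq> 0"
      using v(1) J by (auto simp: w_def)
    ultimately show ?thesis by blast
  qed
qed

text \<open>The argument \<open>z j i\<close> is the \<open>i\<close>-th coordinate of the \<open>j\<close>-th vector, so that a family of vectors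
  is a function of the column index; only \<open>j < k\<close> and \<open>i < n\<close> matter. Coefficients stand on the
  right, as in the product of a matrix with a column.\<close>

definition lin_indep :: "nat \<Rightarrow> nat \<Rightarrow> (nat \<Rightarrow> nat \<Rightarrow> 'a::semiring_0) \<Rightarrow> bool"
  where "lin_indep n k z \<longleftrightarrow>
    (\<forall>a. (\<forall>i<n. (\<Sum>j<k. z j i * a j) = 0) \<longrightarrow> (\<forall>j<k. a j = 0))"

lemma lin_indepD:
  "lin_indep n k z \<Longrightarrow> (\<And>i. i < n \<Longrightarrow> (\<Sum>j<k. z j i * a j) = 0) \<Longrightarrow> j < k \<Longrightarrow> a j = 0"
  by (auto simp: lin_indep_def)

lemma index_mult_mat_sum:
  assumes "A \<in> carrier_mat n m" "B \<in> carrier_mat m p" "i < n" "j < p"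
  shows "(A * B) $$ (i, j) = (\<Sum>l<m. A $$ (i, l) * B $$ (l, j))"
  using assms by (auto simp: scalar_prod_def atLeast0LessThan)

lemma mult_mat_eq_1_iff:
  assumes "A \<in> carrier_mat n m" "B \<in> carrier_mat m n"
  shows "A * B = 1\<^sub>m n \<longleftrightarrow>
    (\<forall>i<n. \<forall>j<n. (\<Sum>l<m. A $$ (i, l) * B $$ (l, j)) = (if i = j then 1 else 0))"
proof -
  have "A * B = 1\<^sub>m n \<longleftrightarrow> (\<forall>i<n. \<forall>j<n. (A * B) $$ (i, j) = (if i = j then 1 else 0))"
    using assms by (auto simp: mat_eq_iff)
  then show ?thesis
    using assms by (simp add: index_mult_mat_sum del: index_mult_mat(1))
qed

lemma left_inverse_imp_lin_indep:
  fixes A :: "'a::semiring_1 mat"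
  assumes A: "A \<in> carrier_mat n n" and B: "B \<in> carrier_mat n n" and BA: "B * A = 1\<^sub>m n"
  shows "lin_indep n n (\<lambda>j i. A $$ (i, j))"
  unfolding lin_indep_def
proof (intro allI impI)
  fix a j assume a: "\<forall>i<n. (\<Sum>j<n. A $$ (i, j) * a j) = 0" and j: "j < n"
  have "a j = (\<Sum>l<n. (if j = l then 1 else 0) * a l)"
    using j by (simp add: if_distrib[where f="\<lambda>x. x * _"] sum.delta cong: if_cong)
  also have "\<dots> = (\<Sum>l<n. (\<Sum>i<n. B $$ (j, i) * A $$ (i, l)) * a l)"
    using BA j unfolding mult_mat_eq_1_iff[OF B A] by (intro sum.cong) auto
  also have "\<dots> = (\<Sum>i<n. B $$ (j, i) * (\<Sum>l<n. A $$ (i, l) * a l))"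
    unfolding sum_distrib_right sum_distrib_left mult.assoc by (rule sum.swap)
  also have "\<dots> = 0" using a by simp
  finally show "a j = 0" .
qed

text \<open>The augmented matrix \<open>(A | e\<^sub>r)\<close> has more columns than rows, hence a nontrivial kernel vector.
  Its last coordinate cannot vanish, since the columns of \<open>A\<close> are independent, and dividing by it
  solves \<open>A w = e\<^sub>r\<close>.\<close>

lemma lin_indep_imp_right_inverse:
  fixes A :: "'a::division_ring mat"
  assumes A: "A \<in> carrier_mat n n" and indep: "lin_indep n n (\<lambda>j i. A $$ (i, j))"
  shows "\<exists>B\<in>carrier_mat n n. A * B = 1\<^sub>m n"
proof -
  have "\<exists>w. \<forall>i<n. (\<Sum>j<n. A $$ (i, j) * w j) = (if i = r then 1 else 0)" for r
  proof -
    define a where "a i j = (if j < n then A $$ (i, j) else if i = r then 1 else 0)" for i j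
    obtain v where v: "\<exists>j\<in>{..n}. v j \<noteq> 0" "\<forall>i\<in>{..<n}. (\<Sum>j\<in>{..n}. a i j * v j) = 0"
      using underdetermined_system[of "{..<n}" "{..n}" a] by auto
    have eq: "(\<Sum>j<n. A $$ (i, j) * v j) + (if i = r then v n else 0) = 0" if "i < n" for i
    proof -
      have "(\<Sum>j<n. a i j * v j) = (\<Sum>j<n. A $$ (i, j) * v j)"
        by (intro sum.cong) (auto simp: a_def)
      then show ?thesis
        using bspec[OF v(2), of i] that
          by (auto simp: a_def simp flip: lessThan_Suc_atMost split: if_splits)
    qed
    have "v n \<noteq> 0"
    proof
      assume "v n = 0"
      then have "(\<Sum>j<n. A $$ (i, j) * v j) = 0" if "i < n" for i
        using eq[OF that] by (simp split: if_splits)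
      then have "v j = 0" if "j < n" for j
        using lin_indepD[OF indep _ that, of v] by simp
      with v(1) \<open>v n = 0\<close> show False by (metis atMost_iff le_neq_implies_less)
    qed
    have "(\<Sum>j<n. A $$ (i, j) * (- v j * inverse (v n))) = (if i = r then 1 else 0)"
      if "i < n" for i
    proof -
      have "(\<Sum>j<n. A $$ (i, j) * (- v j * inverse (v n))) =
          - (\<Sum>j<n. A $$ (i, j) * v j) * inverse (v n)"
        by (simp add: sum_distrib_right sum_negf mult.assoc)
      also have "- (\<Sum>j<n. A $$ (i, j) * v j) = (if i = r then v n else 0)"
        using eq[OF that] by (simp add: eq_neg_iff_add_eq_0 add.commute neg_eq_iff_add_eq_0)
      finally show ?thesis using \<open>v n \<noteq> 0\<close> by simp
    qed
    then show ?thesis by (intro exI[of _ "\<lambda>j. - v j * inverse (v n)"]) simp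
  qed
  then obtain w where w: "\<And>r i. i < n \<Longrightarrow> (\<Sum>j<n. A $$ (i, j) * w r j) = (if i = r then 1 else 0)"
    by metis
  have "A * mat n n (\<lambda>(j, r). w r j) = 1\<^sub>m n"
    using A w by (subst mult_mat_eq_1_iff) auto
  then show ?thesis by (intro bexI[of _ "mat n n (\<lambda>(j, r). w r j)"]) auto
qed

text \<open>A right inverse \<open>B\<close> is itself injective, so it has a right inverse \<open>C\<close>, and \<open>A = A B C = C\<close>.\<close>

lemma lin_indep_imp_inverse:
  fixes A :: "'a::division_ring mat"
  assumes A: "A \<in> carrier_mat n n" and indep: "lin_indep n n (\<lambda>j i. A $$ (i, j))"
  shows "\<exists>B\<in>carrier_mat n n. A * B = 1\<^sub>m n \<and> B * A = 1\<^sub>m n"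
proof -
  obtain B where B: "B \<in> carrier_mat n n" "A * B = 1\<^sub>m n"
    using lin_indep_imp_right_inverse[OF A indep] by blast
  obtain C where C: "C \<in> carrier_mat n n" "B * C = 1\<^sub>m n"
    using lin_indep_imp_right_inverse[OF B(1) left_inverse_imp_lin_indep[OF B(1) A B(2)]] by blast
  have "A = A * (B * C)" using A C by simp
  also have "\<dots> = (A * B) * C" using A B(1) C(1) by (simp add: assoc_mult_mat)
  also have "\<dots> = C" using B C by simp
  finally show ?thesis using B C by blast
qed

lemma left_inverse_imp_right_inverse:
  fixes A B :: "'a::division_ring mat"
  assumes A: "A \<in> carrier_mat n n" and B: "B \<in> carrier_mat n n" and BA: "B * A = 1\<^sub>m n"
  shows "A * B = 1\<^sub>m n"
proof -
  obtain C where C: "C \<in> carrier_mat n n" "A * C = 1\<^sub>m n"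
    using lin_indep_imp_right_inverse[OF A left_inverse_imp_lin_indep[OF A B BA]] by blast
  have "B = B * (A * C)" using B C by simp
  also have "\<dots> = (B * A) * C" using A B C(1) by (simp add: assoc_mult_mat)
  also have "\<dots> = C" using BA C by simp
  finally show ?thesis using C by simp
qed

lemma invertible_mat_iff_lin_indep:
  fixes A :: "'a::division_ring mat"
  assumes A: "A \<in> carrier_mat n n"
  shows "invertible_mat A \<longleftrightarrow> lin_indep n n (\<lambda>j i. A $$ (i, j))"
proof
  assume "invertible_mat A"
  then obtain B where B: "A * B = 1\<^sub>m n" "B * A = 1\<^sub>m (dim_row B)"
    using A by (auto simp: invertible_mat_def inverts_mat_def)
  have "dim_col B = n" "dim_row B = n"
    using arg_cong[OF B(1), of dim_col] arg_cong[OF B(2), of dim_col] A by auto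
  with B show "lin_indep n n (\<lambda>j i. A $$ (i, j))"
    by (intro left_inverse_imp_lin_indep[OF A, of B]) auto
next
  assume "lin_indep n n (\<lambda>j i. A $$ (i, j))"
  from lin_indep_imp_inverse[OF A this] A show "invertible_mat A"
    by (fastforce simp: invertible_mat_def inverts_mat_def)
qed


section \<open>The Hermitian form on coordinate vectors\<close>

definition herm :: "nat \<Rightarrow> (nat \<Rightarrow> 'a) \<Rightarrow> (nat \<Rightarrow> 'a) \<Rightarrow> 'a::{conjugate, semiring_0}"
  where "herm n u v = (\<Sum>i<n. conjugate (u i) * v i)"

definition vnorm :: "nat \<Rightarrow> (nat \<Rightarrow> 'a::real_normed_vector) \<Rightarrow> real"
  where "vnorm n u = sqrt (\<Sum>i<n. (norm (u i))\<^sup>2)"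

definition rescale :: "nat \<Rightarrow> (nat \<Rightarrow> 'a::real_normed_algebra_1) \<Rightarrow> nat \<Rightarrow> 'a"
  where "rescale n u = (\<lambda>i. u i * of_real (inverse (vnorm n u)))"

text \<open>The values \<open>0\<close> and \<open>1\<close> of the form are the entries of the identity matrix, so the columns of
  \<open>x\<close> are orthonormal exactly if \<open>x\<^sup>* x\<close> is the identity; see \<open>stiefel_iff_orthonormal\<close>.\<close>

definition orthonormal ::
    "nat \<Rightarrow> 'j set \<Rightarrow> ('j \<Rightarrow> nat \<Rightarrow> 'a::{conjugate, semiring_1}) \<Rightarrow> bool"
  where "orthonormal n J z \<longleftrightarrow>
    (\<forall>j\<in>J. \<forall>l\<in>J. herm n (z j) (z l) = (if j = l then 1 else 0))"

lemma herm_cong: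
  "(\<And>i. i < n \<Longrightarrow> u i = u' i) \<Longrightarrow> (\<And>i. i < n \<Longrightarrow> v i = v' i) \<Longrightarrow> herm n u v = herm n u' v'"
  by (simp add: herm_def)

context
  fixes n :: nat and u v :: "nat \<Rightarrow> 'a::conjugate_div_algebra"
begin

lemma conjugate_herm: "conjugate (herm n u v) = herm n v u"
  by (simp add: herm_def conjugate_sum conjugate_times)

lemma herm_diff_right: "herm n u (\<lambda>i. v i - w i) = herm n u v - herm n u w"
  by (simp add: herm_def right_diff_distrib sum_subtractf)

lemma herm_mult_right: "herm n u (\<lambda>i. v i * a) = herm n u v * a"
  by (simp add: herm_def sum_distrib_right mult.assoc)

lemma herm_mult_left: "herm n (\<lambda>i. u i * a) v = conjugate a * herm n u v"
  by (simp add: herm_def sum_distrib_left mult.assoc conjugate_times)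

lemma herm_sum_right: "herm n u (\<lambda>i. \<Sum>j\<in>J. z j i * a j) = (\<Sum>j\<in>J. herm n u (z j) * a j)"
  unfolding herm_def sum_distrib_left sum_distrib_right mult.assoc by (rule sum.swap)

lemma herm_self: "herm n u u = of_real ((vnorm n u)\<^sup>2)"
  by (simp add: herm_def vnorm_def sum_nonneg conjugate_times_self of_real_def scaleR_sum_left)

lemma vnorm_eq_0_iff: "vnorm n u = 0 \<longleftrightarrow> (\<forall>i<n. u i = 0)"
  by (auto simp: vnorm_def sum_nonneg_eq_0_iff)

lemma vnorm_nonneg: "vnorm n u \<ge> 0"
  by (simp add: vnorm_def sum_nonneg)

lemma vnorm_mult_of_real: "vnorm n (\<lambda>i. of_real r * u i) = \<bar>r\<bar> * vnorm n u"
  by (simp add: vnorm_def norm_mult power_mult_distrib real_sqrt_mult flip: sum_distrib_left)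

end

lemma herm_rescale_self:
  fixes u :: "nat \<Rightarrow> 'a::conjugate_div_algebra"
  assumes "\<exists>i<n. u i \<noteq> 0"
  shows "herm n (rescale n u) (rescale n u) = 1"
proof -
  have "vnorm n u \<noteq> 0" using assms by (simp add: vnorm_eq_0_iff)
  then show ?thesis
    unfolding rescale_def herm_mult_right herm_mult_left herm_self conjugate_of_real
      of_real_mult[symmetric] of_real_eq_1_iff
    by (simp add: power2_eq_square field_simps)
qed

text \<open>An orthonormal family is an isometry: the coefficient \<open>a\<^sub>l\<close> is recovered by pairing the
  combination with the \<open>l\<close>-th vector.\<close>

lemma vnorm_orthonormal_combination:
  fixes z :: "nat \<Rightarrow> nat \<Rightarrow> 'a::conjugate_div_algebra"
  assumes z: "orthonormal n {..<k} z"
  shows "vnorm n (\<lambda>i. \<Sum>j<k. z j i * a j) = vnorm k a"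
proof -
  let ?s = "\<lambda>i. \<Sum>j<k. z j i * a j"
  have coeff: "herm n (z l) ?s = a l" if "l < k" for l
  proof -
    have "herm n (z l) ?s = (\<Sum>j<k. (if l = j then 1 else 0) * a j)"
      unfolding herm_sum_right using z that by (intro sum.cong) (auto simp: orthonormal_def)
    also have "\<dots> = a l"
      using that by (simp add: if_distrib[where f="\<lambda>x. x * _"] cong: if_cong)
    finally show ?thesis .
  qed
  have "herm n ?s ?s = (\<Sum>l<k. herm n ?s (z l) * a l)"
    by (rule herm_sum_right)
  also have "\<dots> = (\<Sum>l<k. conjugate (a l) * a l)"
    using coeff by (intro sum.cong) (auto simp flip: conjugate_herm[of n "z _" ?s])
  finally have "herm n ?s ?s = herm k a a" by (simp add: herm_def)
  then have "(vnorm n ?s)\<^sup>2 = (vnorm k a)\<^sup>2"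
    unfolding herm_self of_real_eq_iff .
  then show ?thesis by (simp add: vnorm_nonneg)
qed

text \<open>As long as there are fewer than \<open>n\<close> vectors, orthogonality to all of them is an underdetermined
  system; a normalised solution is the next vector.\<close>

lemma orthonormal_extend:
  fixes z :: "'j \<Rightarrow> nat \<Rightarrow> 'a::conjugate_div_algebra"
  assumes "finite S" "finite J" "J \<inter> S = {}" "card J + card S \<le> n" "orthonormal n J z"
  shows "\<exists>z'. orthonormal n (J \<union> S) z' \<and> (\<forall>j\<in>J. z' j = z j)"
  using assms
proof (induction S rule: finite_induct)
  case empty
  then show ?case by auto
next
  case (insert s S)
  then obtain z' where z': "orthonormal n (J \<union> S) z'" "\<forall>j\<in>J. z' j = z j"
    by auto
  have "card (J \<union> S) < card {..<n}"
    using insert by (subst card_Un_disjoint) auto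
  then obtain v where v: "\<exists>i<n. v i \<noteq> 0" "\<And>j. j \<in> J \<union> S \<Longrightarrow> herm n (z' j) v = 0"
    using underdetermined_system[of "J \<union> S" "{..<n}" "\<lambda>j i. conjugate (z' j i)"] insert
    by (auto simp: herm_def)
  have s: "s \<notin> J \<union> S" using insert by auto
  have right: "herm n (z' j) (rescale n v) = 0" if "j \<in> J \<union> S" for j
    using v(2)[OF that] by (simp add: rescale_def herm_mult_right)
  have left: "herm n (rescale n v) (z' j) = 0" if "j \<in> J \<union> S" for j
    using right[OF that] conjugate_herm[of n "z' j" "rescale n v"] by simp
  have "orthonormal n (insert s (J \<union> S)) (z'(s := rescale n v))"
    using z'(1) s left right herm_rescale_self[OF v(1)]
    by (auto simp: orthonormal_def)
  moreover have "\<forall>j\<in>J. (z'(s := rescale n v)) j = z j"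
    using z'(2) s by auto
  ultimately show ?case by auto
qed


section \<open>Gram--Schmidt orthonormalisation\<close>

function gram_schmidt ::
    "nat \<Rightarrow> (nat \<Rightarrow> nat \<Rightarrow> 'a::conjugate_div_algebra) \<Rightarrow> nat \<Rightarrow> nat \<Rightarrow> 'a"
  where "gram_schmidt n z j = rescale n
    (\<lambda>i. z j i - (\<Sum>l<j. gram_schmidt n z l i * herm n (gram_schmidt n z l) (z j)))"
  by auto
termination by (relation "Wellfounded.measure (\<lambda>(n, z, j). j)") auto

declare gram_schmidt.simps [simp del]

text \<open>The vector before normalisation, named because the process works exactly as long as it is
  nonzero.\<close>

definition gs_residue ::
    "nat \<Rightarrow> (nat \<Rightarrow> nat \<Rightarrow> 'a::conjugate_div_algebra) \<Rightarrow> nat \<Rightarrow> nat \<Rightarrow> 'a"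
  where "gs_residue n z j =
    (\<lambda>i. z j i - (\<Sum>l<j. gram_schmidt n z l i * herm n (gram_schmidt n z l) (z j)))"

lemma gram_schmidt_eq: "gram_schmidt n z j = rescale n (gs_residue n z j)"
  unfolding gs_residue_def by (rule gram_schmidt.simps)

text \<open>The residue is a combination of the first \<open>j + 1\<close> vectors in which the \<open>j\<close>-th has coefficient
  \<open>1\<close>; this is why it cannot vanish for an independent family.\<close>

lemma gs_residue_combination:
  fixes z :: "nat \<Rightarrow> nat \<Rightarrow> 'a::conjugate_div_algebra"
  assumes "j < k"
  shows "\<exists>a. a j = 1 \<and> (\<forall>m. j < m \<longrightarrow> a m = 0) \<and> (\<forall>i. gs_residue n z j i = (\<Sum>m<k. z m i * a m))"
  using assms
proof (induction j rule: less_induct)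
  case (less j)
  then have "\<forall>l<j. \<exists>a. (\<forall>m. l < m \<longrightarrow> a m = 0) \<and> (\<forall>i. gs_residue n z l i = (\<Sum>m<k. z m i * a m))"
    by (meson less_trans)
  then obtain a where
    a: "\<And>l m. l < j \<Longrightarrow> l < m \<Longrightarrow> a l m = 0"
       "\<And>l i. l < j \<Longrightarrow> gs_residue n z l i = (\<Sum>m<k. z m i * a l m)"
    by metis
  define r where "r l = of_real (inverse (vnorm n (gs_residue n z l))) *
    herm n (gram_schmidt n z l) (z j)" for l
  define b where "b m = (\<Sum>l<j. a l m * r l)" for m
  have "gs_residue n z j i = (\<Sum>m<k. z m i * ((if m = j then 1 else 0) - b m))" for i
  proof -
    have "(\<Sum>l<j. gram_schmidt n z l i * herm n (gram_schmidt n z l) (z j)) =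
        (\<Sum>l<j. (\<Sum>m<k. z m i * a l m) * r l)"
      using a(2) by (intro sum.cong) (auto simp: gram_schmidt_eq[of n z] rescale_def r_def mult.assoc)
    also have "\<dots> = (\<Sum>m<k. z m i * b m)"
      unfolding b_def sum_distrib_left sum_distrib_right mult.assoc by (rule sum.swap)
    finally show ?thesis
      using less.prems
      by (simp add: gs_residue_def right_diff_distrib sum_subtractf
          if_distrib[where f="\<lambda>x. _ * x"] cong: if_cong)
  qed
  moreover have "b m = 0" if "j \<le> m" for m
    unfolding b_def using that a(1) by (intro sum.neutral) auto
  ultimately show ?case
    by (intro exI[of _ "\<lambda>m. (if m = j then 1 else 0) - b m"]) auto
qed

lemma gs_residue_nonzero:
  assumes z: "lin_indep n k z" and j: "j < k"
  shows "\<exists>i<n. gs_residue n z j i \<noteq> 0"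
proof (rule ccontr)
  assume 0: "\<not> ?thesis"
  obtain a where a: "a j = 1" "\<forall>i. gs_residue n z j i = (\<Sum>m<k. z m i * a m)"
    using gs_residue_combination[OF j] by metis
  have "(\<Sum>m<k. z m i * a m) = 0" if "i < n" for i
    using 0 a(2) that by simp
  then have "a j = 0"
    by (rule lin_indepD[OF z _ j])
  with a(1) show False by simp
qed

text \<open>Subtracting the projections onto the earlier vectors makes the residue orthogonal to them,
  provided that these are already orthonormal among themselves.\<close>

lemma orthonormal_gram_schmidt:
  assumes z: "lin_indep n k z"
  shows "orthonormal n {..<k} (gram_schmidt n z)"
proof -
  let ?q = "gram_schmidt n z"
  have self: "herm n (?q j) (?q j) = 1" if "j < k" for j
    using herm_rescale_self[OF gs_residue_nonzero[OF z that]] by (simp add: gram_schmidt_eq)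
  have orth: "herm n (?q l) (?q j) = 0" if "l < j" "j < k" for l j
    using that
  proof (induction j arbitrary: l rule: less_induct)
    case (less j)
    have ql: "herm n (?q l) (?q m) = (if m = l then 1 else 0)" if "m < j" for m
    proof (cases l m rule: linorder_cases)
      case less': less
      with less.IH[OF that, of l] that less.prems show ?thesis by auto
    next
      case equal
      with self[of m] that less.prems show ?thesis by auto
    next
      case greater
      then have "herm n (?q m) (?q l) = 0" using less by auto
      then show ?thesis using greater conjugate_herm[of n "?q m" "?q l"] by auto
    qed
    have "herm n (?q l) (gs_residue n z j) =
        herm n (?q l) (z j) - (\<Sum>m<j. herm n (?q l) (?q m) * herm n (?q m) (z j))"
      unfolding gs_residue_def herm_diff_right herm_sum_right ..
    also have "(\<Sum>m<j. herm n (?q l) (?q m) * herm n (?q m) (z j)) = herm n (?q l) (z j)"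
      using ql less.prems
      by (simp add: if_distrib[where f="\<lambda>x. x * _"] cong: if_cong)
    finally show ?case
      by (simp add: gram_schmidt_eq[of n z j] rescale_def herm_mult_right)
  qed
  have "herm n (?q j) (?q l) = 0" if "l < j" "j < k" for l j
    using orth[OF that] conjugate_herm[of n "?q l" "?q j"] by simp
  with self orth show ?thesis
    unfolding orthonormal_def by (metis lessThan_iff linorder_neqE_nat)
qed

text \<open>For an orthonormal family all the projections vanish and all the norms are \<open>1\<close>.\<close>

lemma gram_schmidt_orthonormal:
  assumes z: "orthonormal n {..<k} z" and "j < k"
  shows "gram_schmidt n z j = z j"
  using assms(2)
proof (induction j rule: less_induct)
  case (less j)
  have "herm n (z l) (z j) = 0" if "l < j" for l
    using z that less.prems by (auto simp: orthonormal_def)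
  then have res: "gs_residue n z j = z j"
    using less by (simp add: gs_residue_def)
  have "herm n (z j) (z j) = 1"
    using z less.prems by (simp add: orthonormal_def)
  then have "(of_real ((vnorm n (z j))\<^sup>2) :: 'a) = of_real 1"
    unfolding herm_self by simp
  then have "(vnorm n (z j))\<^sup>2 = 1"
    unfolding of_real_eq_iff .
  then have "vnorm n (z j) = 1"
    using vnorm_nonneg[of n "z j"] by (simp add: power2_eq_1_iff)
  then show ?case
    by (simp add: gram_schmidt_eq res rescale_def)
qed

lemma continuous_map_mult:
  fixes f g :: "'x \<Rightarrow> 'a::real_normed_algebra"
  shows "continuous_map X euclidean f \<Longrightarrow> continuous_map X euclidean g \<Longrightarrow>
    continuous_map X euclidean (\<lambda>x. f x * g x)"
  by (simp add: continuous_map_atin tendsto_mult)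

lemma continuous_map_of_real:
  "continuous_map X euclideanreal f \<Longrightarrow>
    continuous_map X euclidean (\<lambda>x. of_real (f x) :: 'a::real_normed_algebra_1)"
  by (simp add: continuous_map_atin tendsto_of_real)

lemma continuous_map_conjugate:
  fixes f :: "'x \<Rightarrow> 'a::conjugate_div_algebra"
  assumes "continuous_map X euclidean f"
  shows "continuous_map X euclidean (\<lambda>x. conjugate (f x))"
proof -
  have "continuous_on UNIV (conjugate :: 'a \<Rightarrow> 'a)"
    unfolding continuous_on_iff dist_norm by (auto simp flip: conjugate_diff)
  then show ?thesis
    using continuous_map_compose[OF assms, of euclidean conjugate]
    by (simp add: continuous_map_iff_continuous2 o_def)
qed

lemma continuous_map_herm:
  fixes u v :: "'x \<Rightarrow> nat \<Rightarrow> 'a::conjugate_div_algebra"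
  assumes "\<And>i. i < n \<Longrightarrow> continuous_map X euclidean (\<lambda>x. u x i)"
    and "\<And>i. i < n \<Longrightarrow> continuous_map X euclidean (\<lambda>x. v x i)"
  shows "continuous_map X euclidean (\<lambda>x. herm n (u x) (v x))"
  unfolding herm_def using assms
  by (intro continuous_map_sum continuous_map_mult continuous_map_conjugate) auto

lemma continuous_map_rescale:
  fixes u :: "'x \<Rightarrow> nat \<Rightarrow> 'a::conjugate_div_algebra"
  assumes u: "\<And>i. i < n \<Longrightarrow> continuous_map X euclidean (\<lambda>x. u x i)"
    and nonzero: "\<And>x. x \<in> topspace X \<Longrightarrow> \<exists>i<n. u x i \<noteq> 0" and i: "i < n"
  shows "continuous_map X euclidean (\<lambda>x. rescale n (u x) i)"
proof -
  have "continuous_map X euclidean (\<lambda>x. \<Sum>i<n. (norm (u x i))\<^sup>2)"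
    using u by (intro continuous_map_sum continuous_map_real_pow continuous_map_norm) auto
  then have "continuous_map X euclidean (\<lambda>x. vnorm n (u x))"
    unfolding vnorm_def by (simp add: continuous_map_atin tendsto_real_sqrt)
  moreover have "vnorm n (u x) \<noteq> 0" if "x \<in> topspace X" for x
    using nonzero[OF that] by (simp add: vnorm_eq_0_iff)
  ultimately have "continuous_map X euclidean (\<lambda>x. inverse (vnorm n (u x)))"
    by (simp add: continuous_map_atin tendsto_inverse)
  then show ?thesis
    unfolding rescale_def by (intro continuous_map_mult continuous_map_of_real u[OF i])
qed

text \<open>The only division in the process is by the norm of the residues, which independence keeps away
  from \<open>0\<close>.\<close>

lemma continuous_map_gram_schmidt:
  fixes z :: "'x \<Rightarrow> nat \<Rightarrow> nat \<Rightarrow> 'a::conjugate_div_algebra"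
  assumes cont: "\<And>j i. j < k \<Longrightarrow> i < n \<Longrightarrow> continuous_map X euclidean (\<lambda>x. z x j i)"
    and indep: "\<And>x. x \<in> topspace X \<Longrightarrow> lin_indep n k (z x)"
    and "j < k" "i < n"
  shows "continuous_map X euclidean (\<lambda>x. gram_schmidt n (z x) j i)"
  using assms(3,4)
proof (induction j arbitrary: i rule: less_induct)
  case (less j)
  have "continuous_map X euclidean (\<lambda>x. gs_residue n (z x) j i)" if "i < n" for i
    unfolding gs_residue_def using less that
    by (intro continuous_map_diff continuous_map_sum continuous_map_mult continuous_map_herm cont)
      auto
  then show ?case
    unfolding gram_schmidt_eq
    using gs_residue_nonzero[OF indep] less.prems by (intro continuous_map_rescale) auto
qed


section \<open>Spaces of matrices\<close>

lemma topspace_mat_topology [simp]: "topspace (mat_topology n k) = carrier_mat n k"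
  by (auto simp: mat_topology_def topspace_pullback_topology)

lemma continuous_map_mat_entry:
  assumes "i < n" "j < k"
  shows "continuous_map (mat_topology n k) euclidean (\<lambda>A. A $$ (i, j))"
proof -
  let ?I = "{..<n} \<times> {..<k}"
  have "continuous_map (product_topology (\<lambda>_. euclidean) ?I) euclidean (\<lambda>f. f (i, j))"
    using assms by (intro continuous_map_product_projection) auto
  then have "continuous_map (mat_topology n k) euclidean
      ((\<lambda>f. f (i, j)) \<circ> (\<lambda>A. restrict (\<lambda>ij. A $$ ij) ?I))"
    unfolding mat_topology_def by (rule continuous_map_pullback)
  then show ?thesis using assms by (simp add: o_def)
qed

lemma continuous_map_into_mat_topology:
  assumes "\<And>x. x \<in> topspace X \<Longrightarrow> f x \<in> carrier_mat n k"
    and "\<And>i j. i < n \<Longrightarrow> j < k \<Longrightarrow> continuous_map X euclidean (\<lambda>x. f x $$ (i, j))"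
  shows "continuous_map X (mat_topology n k) f"
  unfolding mat_topology_def
proof (rule continuous_map_pullback')
  show "continuous_map X (product_topology (\<lambda>_. euclidean) ({..<n} \<times> {..<k}))
      ((\<lambda>A. restrict (\<lambda>ij. A $$ ij) ({..<n} \<times> {..<k})) \<circ> f)"
    using assms(2) by (auto simp: continuous_map_componentwise)
qed (use assms(1) in auto)

lemma stiefel_iff_orthonormal:
  fixes x :: "'a::{conjugate, semiring_1} mat"
  shows "x \<in> stiefel n k \<longleftrightarrow>
    x \<in> carrier_mat n k \<and> orthonormal n {..<k} (\<lambda>j i. x $$ (i, j))"
proof -
  have "conj_transpose x * x = 1\<^sub>m k \<longleftrightarrow> orthonormal n {..<k} (\<lambda>j i. x $$ (i, j))"
    if "x \<in> carrier_mat n k"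
    using that
    by (subst mult_mat_eq_1_iff[of _ k n]) (auto simp: conj_transpose_def orthonormal_def herm_def)
  then show ?thesis by (auto simp: stiefel_def)
qed

lemma index_append_rows:
  assumes "A \<in> carrier_mat m k" "B \<in> carrier_mat l k" "i < m + l" "j < k"
  shows "(A @\<^sub>r B) $$ (i, j) = (if i < m then A $$ (i, j) else B $$ (i - m, j))"
  using assms by (auto simp: append_rows_def)

text \<open>Invertibility of \<open>\<pi> + P\<^sup>*\<close> expressed through the entries of \<open>y\<close>: by a condition on its kernel,
  which is the form that both openness and the contraction use.\<close>

lemma mem_stiefel_Omega_iff:
  fixes P :: "'a::conjugate_div_algebra mat"
  assumes "k \<le> n" and P: "P \<in> carrier_mat k k"
  shows "y \<in> stiefel_Omega n k P \<longleftrightarrow> y \<in> stiefel n k \<and>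
    lin_indep k k (\<lambda>j i. y $$ (n - k + i, j) + conjugate (P $$ (j, i)))"
    (is "_ \<longleftrightarrow> _ \<and> ?indep y")
proof -
  have inv: "invertible_mat (\<pi> + conj_transpose P) \<longleftrightarrow> ?indep (\<tau> @\<^sub>r \<pi>)"
    if "\<tau> \<in> carrier_mat (n - k) k" "\<pi> \<in> carrier_mat k k" for \<tau> \<pi> :: "'a mat"
  proof -
    have "invertible_mat (\<pi> + conj_transpose P) \<longleftrightarrow>
        lin_indep k k (\<lambda>j i. (\<pi> + conj_transpose P) $$ (i, j))"
      using that P by (intro invertible_mat_iff_lin_indep) (auto simp: conj_transpose_def)
    also have "\<dots> \<longleftrightarrow> ?indep (\<tau> @\<^sub>r \<pi>)"
    proof -
      have "(\<Sum>j<k. (\<pi> + conj_transpose P) $$ (i, j) * a j) =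
          (\<Sum>j<k. ((\<tau> @\<^sub>r \<pi>) $$ (n - k + i, j) + conjugate (P $$ (j, i))) * a j)"
        if "i < k" for i a
        using that P \<open>\<tau> \<in> _\<close> \<open>\<pi> \<in> _\<close>
        by (intro sum.cong) (auto simp: conj_transpose_def index_append_rows[of _ "n - k" k _ k])
      then show ?thesis by (simp add: lin_indep_def)
    qed
    finally show ?thesis .
  qed
  have split: "\<exists>\<tau> \<pi>. y = \<tau> @\<^sub>r \<pi> \<and> \<tau> \<in> carrier_mat (n - k) k \<and> \<pi> \<in> carrier_mat k k"
    if "y \<in> stiefel n k"
  proof -
    let ?t = "mat (n - k) k (\<lambda>(i, j). y $$ (i, j))" and ?p = "mat k k (\<lambda>(i, j). y $$ (n - k + i, j))"
    have "y \<in> carrier_mat n k" using that by (simp add: stiefel_def)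
    then have "y = ?t @\<^sub>r ?p"
      using \<open>k \<le> n\<close> by (auto simp: append_rows_def mat_eq_iff)
    then show ?thesis by (intro exI[of _ ?t] exI[of _ ?p]) auto
  qed
  show ?thesis
    using inv split unfolding stiefel_Omega_def by blast
qed

lemma topspace_stiefel_space [simp]: "topspace (stiefel_space n k) = stiefel n k"
  by (auto simp: stiefel_space_def stiefel_def)

lemma continuous_map_stiefel_entry:
  assumes "i < n" "j < k"
  shows "continuous_map (stiefel_space n k) euclidean (\<lambda>A. A $$ (i, j))"
  unfolding stiefel_space_def
  by (rule continuous_map_from_subtopology[OF continuous_map_mat_entry[OF assms]])


section \<open>Openness\<close>

text \<open>If \<open>m a = 0\<close> then \<open>(1 - c m) a = a\<close>. The sum of the norms of all entries bounds the operator norm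
  of \<open>1 - c m\<close> for the \<open>l\<^sup>1\<close>-norm, so if it is less than \<open>1\<close> only \<open>a = 0\<close> remains.\<close>

lemma almost_left_inverse_imp_lin_indep:
  fixes m :: "nat \<Rightarrow> nat \<Rightarrow> 'a::real_normed_div_algebra"
  assumes small: "(\<Sum>i<k. \<Sum>j<k. norm ((if i = j then 1 else 0) - (\<Sum>l<k. c i l * m j l))) < 1"
  shows "lin_indep k k m"
  unfolding lin_indep_def
proof (intro allI impI)
  fix a j assume a: "\<forall>i<k. (\<Sum>j<k. m j i * a j) = 0" and "j < k"
  let ?e = "\<lambda>i j. (if i = j then 1 else 0) - (\<Sum>l<k. c i l * m j l)"
  define s where "s = (\<Sum>j<k. norm (a j))"
  have a_eq: "a i = (\<Sum>j<k. ?e i j * a j)" if "i < k" for i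
  proof -
    have "(\<Sum>j<k. (\<Sum>l<k. c i l * m j l) * a j) = (\<Sum>l<k. c i l * (\<Sum>j<k. m j l * a j))"
      unfolding sum_distrib_right sum_distrib_left mult.assoc by (rule sum.swap)
    also have "\<dots> = 0" using a by simp
    finally show ?thesis
      using that
      by (simp add: left_diff_distrib sum_subtractf if_distrib[where f="\<lambda>x. x * _"] cong: if_cong)
  qed
  have "s \<le> (\<Sum>i<k. \<Sum>j<k. norm (?e i j) * s)"
    unfolding s_def
  proof (rule sum_mono)
    fix i assume "i \<in> {..<k}"
    then have "norm (a i) = norm (\<Sum>j<k. ?e i j * a j)"
      by (intro arg_cong[OF a_eq]) simp
    also have "\<dots> \<le> (\<Sum>j<k. norm (?e i j) * norm (a j))"
      by (rule order_trans[OF norm_sum]) (simp add: norm_mult)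
    also have "\<dots> \<le> (\<Sum>j<k. norm (?e i j) * (\<Sum>j<k. norm (a j)))"
      by (intro sum_mono mult_left_mono member_le_sum) auto
    finally show "norm (a i) \<le> (\<Sum>j<k. norm (?e i j) * (\<Sum>j<k. norm (a j)))" .
  qed
  also have "\<dots> = (\<Sum>i<k. \<Sum>j<k. norm (?e i j)) * s"
    by (simp add: sum_distrib_right)
  finally have "s * (1 - (\<Sum>i<k. \<Sum>j<k. norm (?e i j))) \<le> 0"
    by (simp add: right_diff_distrib mult.commute)
  with small have "s \<le> 0"
    by (simp add: mult_le_0_iff)
  then have "s = 0"
    unfolding s_def by (intro antisym sum_nonneg) auto
  then show "a j = 0"
    using \<open>j < k\<close> by (simp add: s_def sum_nonneg_eq_0_iff)
qed

text \<open>The inverse \<open>C\<close> at one point remains an approximate left inverse at the nearby points.\<close>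

lemma openin_lin_indep:
  fixes m :: "'x \<Rightarrow> nat \<Rightarrow> nat \<Rightarrow> 'a::real_normed_div_algebra"
  assumes cont: "\<And>i j. i < k \<Longrightarrow> j < k \<Longrightarrow> continuous_map X euclidean (\<lambda>x. m x j i)"
  shows "openin X {x \<in> topspace X. lin_indep k k (m x)}"
proof (subst openin_subopen, clarify)
  fix x assume x: "x \<in> topspace X" and indep: "lin_indep k k (m x)"
  let ?A = "mat k k (\<lambda>(i, j). m x j i)"
  have "lin_indep k k (\<lambda>j i. ?A $$ (i, j))"
    using indep by (simp add: lin_indep_def)
  then obtain C where C: "C \<in> carrier_mat k k" "C * ?A = 1\<^sub>m k"
    using lin_indep_imp_inverse[of ?A k] by auto
  define d where "d y = (\<Sum>i<k. \<Sum>j<k.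
    norm ((if i = j then 1 else 0) - (\<Sum>l<k. C $$ (i, l) * m y j l)))" for y
  have "d x = 0"
    using C by (simp add: d_def mult_mat_eq_1_iff[of _ k k])
  moreover have "continuous_map X euclideanreal d"
    unfolding d_def
    by (intro continuous_map_sum continuous_map_norm continuous_map_diff continuous_map_mult cont)
      auto
  then have "openin X {y \<in> topspace X. d y \<in> {..<1}}"
    by (rule openin_continuous_map_preimage) (simp flip: open_openin)
  moreover have "{y \<in> topspace X. d y \<in> {..<1}} \<subseteq> {y \<in> topspace X. lin_indep k k (m y)}"
    using almost_left_inverse_imp_lin_indep unfolding d_def by fastforce
  ultimately show "\<exists>U. openin X U \<and> x \<in> U \<and> U \<subseteq> {y \<in> topspace X. lin_indep k k (m y)}"
    using x by (intro exI[of _ "{y \<in> topspace X. d y \<in> {..<1}}"]) auto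
qed

lemma openin_stiefel_Omega:
  fixes P :: "'a::conjugate_div_algebra mat"
  assumes "k \<le> n" "P \<in> carrier_mat k k"
  shows "openin (stiefel_space n k) (stiefel_Omega n k P)"
proof -
  let ?X = "stiefel_space n k :: 'a mat topology"
  let ?m = "\<lambda>(y :: 'a mat) j i. y $$ (n - k + i, j) + conjugate (P $$ (j, i))"
  have "stiefel_Omega n k P = {y \<in> topspace ?X. lin_indep k k (?m y)}"
    using mem_stiefel_Omega_iff[OF assms] by auto
  moreover have "continuous_map ?X euclidean (\<lambda>y. ?m y j i)" if "i < k" "j < k" for i j
    using that assms(1) by (intro continuous_map_add continuous_map_stiefel_entry) auto
  ultimately show ?thesis
    using openin_lin_indep[of k ?X ?m] by simp
qed


section \<open>Contractibility\<close>

text \<open>The identity \<open>A\<^sup>* A = 1\<close> for a square matrix implies \<open>A A\<^sup>* = 1\<close>: orthonormal columns force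
  orthonormal rows.\<close>

lemma orthonormal_basis_dual:
  fixes z :: "nat \<Rightarrow> nat \<Rightarrow> 'a::conjugate_div_algebra"
  assumes z: "orthonormal n {..<n} z"
  shows "orthonormal n {..<n} (\<lambda>i j. conjugate (z j i))"
proof -
  let ?A = "mat n n (\<lambda>(i, j). z j i)" and ?B = "mat n n (\<lambda>(j, i). conjugate (z j i))"
  have "?B * ?A = 1\<^sub>m n"
    using z by (subst mult_mat_eq_1_iff[of _ n n]) (auto simp: orthonormal_def herm_def)
  then have "?A * ?B = 1\<^sub>m n"
    by (rule left_inverse_imp_right_inverse[rotated 2]) auto
  then show ?thesis
    by (subst (asm) mult_mat_eq_1_iff[of _ n n]) (auto simp: orthonormal_def herm_def)
qed

text \<open>The target of the contraction. With \<open>x\<close> placed in the last \<open>k\<close> columns of a unitary matrix, the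
  adjoint of the last \<open>k\<close> rows of that matrix is a frame with lower block \<open>P\<^sup>*\<close>.\<close>

lemma stiefel_conj_transpose_block:
  fixes T P :: "'a::conjugate_div_algebra mat"
  assumes "k \<le> n" and T: "T \<in> carrier_mat (n - k) k" and P: "P \<in> carrier_mat k k"
    and x: "T @\<^sub>r P \<in> stiefel n k"
  shows "\<exists>c \<in> stiefel n k. \<forall>i<k. \<forall>j<k. c $$ (n - k + i, j) = conjugate (P $$ (j, i))"
proof -
  let ?x = "T @\<^sub>r P"
  define J where "J = {n - k..<n}"
  have "orthonormal n J (\<lambda>j i. ?x $$ (i, j - (n - k)))"
    unfolding orthonormal_def
  proof (intro ballI)
    fix j l assume "j \<in> J" "l \<in> J"
    then have "j - (n - k) < k" "l - (n - k) < k" "j - (n - k) = l - (n - k) \<longleftrightarrow> j = l"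
      using \<open>k \<le> n\<close> by (auto simp: J_def)
    then show "herm n (\<lambda>i. ?x $$ (i, j - (n - k))) (\<lambda>i. ?x $$ (i, l - (n - k))) =
        (if j = l then 1 else 0)"
      using x by (simp add: stiefel_iff_orthonormal orthonormal_def)
  qed
  moreover have "J \<inter> {..<n - k} = {}" "finite J" "card J + card {..<n - k} \<le> n"
    using \<open>k \<le> n\<close> by (auto simp: J_def)
  ultimately obtain z where "orthonormal n (J \<union> {..<n - k}) z"
    and z_J: "\<forall>j\<in>J. z j = (\<lambda>i. ?x $$ (i, j - (n - k)))"
    using orthonormal_extend[of "{..<n - k}" J n] by blast
  moreover have "J \<union> {..<n - k} = {..<n}"
    using \<open>k \<le> n\<close> by (auto simp: J_def)
  ultimately have z: "orthonormal n {..<n} (\<lambda>i j. conjugate (z j i))"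
    using orthonormal_basis_dual by metis
  define c where "c = mat n k (\<lambda>(i, j). conjugate (z i (n - k + j)))"
  have "herm n (\<lambda>i. c $$ (i, j)) (\<lambda>i. c $$ (i, l)) = (if j = l then 1 else 0)"
    if "j < k" "l < k" for j l
  proof -
    have "herm n (\<lambda>i. c $$ (i, j)) (\<lambda>i. c $$ (i, l)) =
        herm n (\<lambda>i. conjugate (z i (n - k + j))) (\<lambda>i. conjugate (z i (n - k + l)))"
      using that by (intro herm_cong) (auto simp: c_def)
    then show ?thesis
      using z that \<open>k \<le> n\<close> by (simp add: orthonormal_def) arith
  qed
  then have "c \<in> stiefel n k"
    by (simp add: stiefel_iff_orthonormal orthonormal_def c_def)
  moreover have "c $$ (n - k + i, j) = conjugate (P $$ (j, i))" if "i < k" "j < k" for i j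
  proof -
    have i: "n - k + i < n" using that \<open>k \<le> n\<close> by arith
    then have "n - k + i \<in> J" by (simp add: J_def)
    with z_J have "z (n - k + i) (n - k + j) = ?x $$ (n - k + j, i)" by simp
    also have "\<dots> = P $$ (j, i)"
      using that T P by (subst index_append_rows) auto
    finally show ?thesis using that i by (simp add: c_def)
  qed
  ultimately show ?thesis by blast
qed

text \<open>Two isometries \<open>c\<close> and \<open>y\<close> map \<open>a\<close> to vectors of the same norm, so \<open>(1 - t) c a + t y a = 0\<close> with
  \<open>a \<noteq> 0\<close> is possible at the midpoint only, where the hypothesis on \<open>c + y\<close> excludes it.\<close>

lemma lin_indep_segment:
  fixes c y :: "nat \<Rightarrow> nat \<Rightarrow> 'a::conjugate_div_algebra"
  assumes c: "orthonormal n {..<k} c" and y: "orthonormal n {..<k} y"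
    and sum: "lin_indep n k (\<lambda>j i. c j i + y j i)"
  shows "lin_indep n k (\<lambda>j i. of_real (1 - t) * c j i + of_real t * y j i)"
  unfolding lin_indep_def
proof (intro allI impI)
  fix a j
  assume a: "\<forall>i<n. (\<Sum>j<k. (of_real (1 - t) * c j i + of_real t * y j i) * a j) = 0" and j: "j < k"
  let ?c = "\<lambda>i. \<Sum>j<k. c j i * a j" and ?y = "\<lambda>i. \<Sum>j<k. y j i * a j"
  have eq: "of_real (1 - t) * ?c i = of_real (- t) * ?y i" if "i < n" for i
  proof -
    have "(\<Sum>j<k. (of_real (1 - t) * c j i + of_real t * y j i) * a j) =
        of_real (1 - t) * ?c i + of_real t * ?y i"
      by (simp only: distrib_right sum.distrib sum_distrib_left mult.assoc)
    with a that show ?thesis by (simp add: eq_neg_iff_add_eq_0)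
  qed
  have "\<bar>1 - t\<bar> * vnorm k a = vnorm n (\<lambda>i. of_real (1 - t) * ?c i)"
    by (simp only: vnorm_mult_of_real vnorm_orthonormal_combination[OF c])
  also have "\<dots> = vnorm n (\<lambda>i. of_real (- t) * ?y i)"
    using eq by (simp add: vnorm_def)
  also have "\<dots> = \<bar>t\<bar> * vnorm k a"
    by (simp only: vnorm_mult_of_real vnorm_orthonormal_combination[OF y] abs_minus_cancel)
  finally have "vnorm k a = 0 \<or> \<bar>1 - t\<bar> = \<bar>t\<bar>" by simp
  then show "a j = 0"
  proof
    assume "vnorm k a = 0"
    then show ?thesis using j by (simp add: vnorm_eq_0_iff)
  next
    assume "\<bar>1 - t\<bar> = \<bar>t\<bar>"
    then have t: "1 - t = 1 / 2" "- t = - (1 / 2)" by (auto simp: abs_if split: if_splits)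
    have "(\<Sum>j<k. (c j i + y j i) * a j) = 0" if "i < n" for i
    proof -
      have "of_real (1 / 2) * (?c i + ?y i) = 0"
        using eq[OF that] unfolding t by (simp add: distrib_left)
      then have "?c i + ?y i = 0"
        by simp
      then show ?thesis by (simp add: distrib_right sum.distrib)
    qed
    then show ?thesis by (rule lin_indepD[OF sum _ j])
  qed
qed

lemma contractible_in_stiefel_Omega:
  fixes T P :: "'a::conjugate_div_algebra mat"
  assumes "k \<le> n" and T: "T \<in> carrier_mat (n - k) k" and P: "P \<in> carrier_mat k k"
    and x: "T @\<^sub>r P \<in> stiefel n k"
  shows "contractible_in (stiefel_Omega n k P) (stiefel_space n k)"
proof -
  let ?E = "stiefel_space n k :: 'a mat topology" and ?U = "stiefel_Omega n k P"
  obtain c where c: "c \<in> stiefel n k"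
    and c_low: "\<And>i j. i < k \<Longrightarrow> j < k \<Longrightarrow> c $$ (n - k + i, j) = conjugate (P $$ (j, i))"
    using stiefel_conj_transpose_block[OF assms] by blast
  define X where "X = prod_topology (top_of_set {0..1::real}) (subtopology ?E ?U)"
  define z where "z = (\<lambda>(t, y :: 'a mat) j i.
    of_real (1 - t) * c $$ (i, j) + of_real t * y $$ (i, j))"
  define h where "h p = mat n k (\<lambda>(i, j). gram_schmidt n (z p) j i)" for p
  have top_X: "topspace X = {0..1} \<times> ?U"
    using mem_stiefel_Omega_iff[OF \<open>k \<le> n\<close> P] by (auto simp: X_def)
  have indep: "lin_indep n k (z p)" if p_X: "p \<in> topspace X" for p
  proof -
    obtain t y where p: "p = (t, y)" "y \<in> ?U"
      using p_X unfolding top_X by blast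
    have y: "y \<in> stiefel n k"
      and low: "lin_indep k k (\<lambda>j i. y $$ (n - k + i, j) + conjugate (P $$ (j, i)))"
      using p(2) mem_stiefel_Omega_iff[OF \<open>k \<le> n\<close> P] by auto
    \<comment> \<open>at the midpoint the last \<open>k\<close> rows already suffice: they form \<open>\<pi> + P\<^sup>*\<close>\<close>
    have "lin_indep n k (\<lambda>j i. c $$ (i, j) + y $$ (i, j))"
      unfolding lin_indep_def
    proof (intro allI impI)
      fix a j assume a: "\<forall>i<n. (\<Sum>j<k. (c $$ (i, j) + y $$ (i, j)) * a j) = 0" and "j < k"
      have "(\<Sum>j<k. (y $$ (n - k + i, j) + conjugate (P $$ (j, i))) * a j) = 0" if "i < k" for i
      proof -
        have "(\<Sum>j<k. (y $$ (n - k + i, j) + conjugate (P $$ (j, i))) * a j) =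
            (\<Sum>j<k. (c $$ (n - k + i, j) + y $$ (n - k + i, j)) * a j)"
          using c_low[OF that] by (intro sum.cong) (auto simp: add.commute)
        also have "\<dots> = 0" using a that \<open>k \<le> n\<close> by simp
        finally show ?thesis .
      qed
      then show "a j = 0" using lin_indepD[OF low _ \<open>j < k\<close>] by blast
    qed
    then show ?thesis
      using lin_indep_segment[of n k "\<lambda>j i. c $$ (i, j)" "\<lambda>j i. y $$ (i, j)" t] c y
      by (simp add: p(1) z_def stiefel_iff_orthonormal)
  qed
  have fst_X: "continuous_map X euclideanreal fst" and snd_X: "continuous_map X ?E snd"
    unfolding X_def
    by (auto intro: continuous_map_into_fulltopology[OF continuous_map_fst]
        continuous_map_into_fulltopology[OF continuous_map_snd])
  have cont_z: "continuous_map X euclidean (\<lambda>p. z p j i)" if "j < k" "i < n" for i j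
  proof -
    have "continuous_map X euclidean (\<lambda>p. snd p $$ (i, j))"
      using continuous_map_compose[OF snd_X continuous_map_stiefel_entry[OF that(2,1)]]
      by (simp add: o_def)
    then have "continuous_map X euclidean
        (\<lambda>p. of_real (1 - fst p) * c $$ (i, j) + of_real (fst p) * snd p $$ (i, j))"
      using fst_X
      by (intro continuous_map_add continuous_map_mult continuous_map_of_real continuous_map_diff)
        auto
    then show ?thesis by (simp add: z_def case_prod_beta)
  qed
  have h_stiefel: "h p \<in> stiefel n k" if "p \<in> topspace X" for p
  proof -
    have "herm n (\<lambda>i. h p $$ (i, j)) (\<lambda>i. h p $$ (i, l)) =
        herm n (gram_schmidt n (z p) j) (gram_schmidt n (z p) l)" if "j < k" "l < k" for j l
      using that by (intro herm_cong) (auto simp: h_def)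
    with orthonormal_gram_schmidt[OF indep[OF that]] show ?thesis
      by (simp add: stiefel_iff_orthonormal orthonormal_def h_def)
  qed
  have "continuous_map X (mat_topology n k) h"
    using continuous_map_gram_schmidt[OF cont_z indep]
    by (intro continuous_map_into_mat_topology) (auto simp: h_def)
  then have cont_h: "continuous_map X ?E h"
    using h_stiefel by (auto simp: stiefel_space_def continuous_map_in_subtopology)
  have fixed: "h p = w" if "z p = (\<lambda>j i. w $$ (i, j))" "w \<in> stiefel n k" for p w
    using that gram_schmidt_orthonormal[of n k "\<lambda>j i. w $$ (i, j)"]
    by (auto simp: h_def mat_eq_iff stiefel_iff_orthonormal)
  have "h (0, y) = c" for y
    by (rule fixed[OF _ c]) (simp add: z_def)
  moreover have "h (1, y) = y" if "y \<in> ?U" for y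
    using that mem_stiefel_Omega_iff[OF \<open>k \<le> n\<close> P] by (intro fixed) (auto simp: z_def)
  ultimately have "homotopic_with (\<lambda>_. True) (subtopology ?E ?U) ?E (\<lambda>_. c) (\<lambda>y. y)"
    using cont_h unfolding X_def by (subst homotopic_with) auto
  moreover have "?U \<subseteq> topspace ?E"
    using mem_stiefel_Omega_iff[OF \<open>k \<le> n\<close> P] by auto
  ultimately show ?thesis
    unfolding contractible_in_def by blast
qed

theorem theorem2:
  fixes n k :: nat
  assumes "k \<le> n"
  shows
    "(\<forall>(T :: real mat) \<in> carrier_mat (n - k) k. \<forall>P \<in> carrier_mat k k. T @\<^sub>r P \<in> stiefel n k \<longrightarrow>
       openin (stiefel_space n k) (stiefel_Omega n k P) \<and>
       contractible_in (stiefel_Omega n k P) (stiefel_space n k)) \<and>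
     (\<forall>(T :: complex mat) \<in> carrier_mat (n - k) k. \<forall>P \<in> carrier_mat k k. T @\<^sub>r P \<in> stiefel n k \<longrightarrow>
       openin (stiefel_space n k) (stiefel_Omega n k P) \<and>
       contractible_in (stiefel_Omega n k P) (stiefel_space n k)) \<and>
     (\<forall>(T :: quat mat) \<in> carrier_mat (n - k) k. \<forall>P \<in> carrier_mat k k. T @\<^sub>r P \<in> stiefel n k \<longrightarrow>
       openin (stiefel_space n k) (stiefel_Omega n k P) \<and>
       contractible_in (stiefel_Omega n k P) (stiefel_space n k))"
  by (intro conjI ballI impI;
      (rule openin_stiefel_Omega[OF assms], assumption
        | rule contractible_in_stiefel_Omega[OF assms], assumption, assumption, assumption))

end
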